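(* Let $d$ and $k$ be integers with $1\le k\le d-1$. There are constants $c_1=c_1(d,k)>0$ and $c_2=c_2(d,k)>0$ such that the following holds. Let $\Lambda\subseteq\mathbb{R}^d$ be a $d$-dimensional lattice and let $K\subseteq\mathbb{R}^d$ be a $d$-dimensional compact convex body symmetric about the origin, and write $\lambda_i=\lambda_i(\Lambda,K)$ for $i=1,\dots,d$. Assume $\lambda_d\le 1$. Then $\Lambda\cap K$ can be covered by at most $c_2(\lambda_{k+1}\cdots\lambda_d)^{-1}$ $k$-dimensional affine subspaces of $\mathbb{R}^d$, and every family of $k$-dimensional affine subspaces of $\mathbb{R}^d$ covering $\Lambda\cap K$ has at least $c_1(\lambda_{k+1}\cdots\lambda_d)^{-1}$ members.
   Context: A $d$-dimensional lattice is the set of all integer linear combinations of $d$ linearly independent vectors of $\mathbb{R}^d$. For a lattice $\Lambda$ and a compact convex body $K$ symmetric about the origin ($K=-K$), the $i$th successive minimum is $\lambda_i(\Lambda,K)=\inf\{\lambda\in\mathbb{R}:\dim(\Lambda\cap(\lambda K))\ge i\}$, where $\dim$ denotes the dimension of the affine hull. *)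

theory Defs
  imports "HOL-Analysis.Analysis"
begin

definition is_lattice :: "'a::euclidean_space set \<Rightarrow> bool" where
  "is_lattice L \<longleftrightarrow> (\<exists>B. finite B \<and> independent B \<and> card B = DIM('a) \<and>
      L = {(\<Sum>b\<in>B. of_int (f b) *\<^sub>R b) | f. True})"

definition sym_convex_body :: "'a::euclidean_space set \<Rightarrow> bool" where
  "sym_convex_body K \<longleftrightarrow> compact K \<and> convex K \<and> interior K \<noteq> {} \<and> (\<forall>x\<in>K. - x \<in> K)"

definition succ_min :: "'a::euclidean_space set \<Rightarrow> 'a set \<Rightarrow> nat \<Rightarrow> real" where
  "succ_min L K i = Inf {t::real. t > 0 \<and> aff_dim (L \<inter> ((\<lambda>x. t *\<^sub>R x) ` K)) \<ge> int i}"

definition affine_subspace_dim :: "nat \<Rightarrow> 'a::euclidean_space set \<Rightarrow> bool" where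
  "affine_subspace_dim k A \<longleftrightarrow> affine A \<and> A \<noteq> {} \<and> aff_dim A = int k"

end

theory Submission
  imports Defs
begin

text \<open>
  Let \<open>p\<close> be the gauge of \<open>K\<close> and choose \<open>v\<^sub>i\<close> greedily as a lattice vector outside
  \<open>span {v\<^sub>1, \<dots>, v\<^bsub>i-1\<^esub>}\<close> with minimal gauge; then \<open>p v\<^sub>i = \<lambda>\<^sub>i\<close>.

  Lower bound: the points \<open>\<Sum> a\<^sub>i v\<^sub>i\<close> with \<open>0 \<le> a\<^sub>i \<le> n\<^sub>i = \<lfloor>1 / (d \<lambda>\<^sub>i)\<rfloor>\<close> lie in \<open>K\<close>. On a
  \<open>k\<close>-dimensional affine subspace some \<open>k\<close> of the coordinates determine the others, so it
  contains at most \<open>(n\<^sub>1 + 1) \<cdots> (n\<^sub>k + 1)\<close> of these points.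

  Upper bound: cover by translates of \<open>span {v\<^sub>1, \<dots>, v\<^sub>k}\<close>. Each translate meeting \<open>\<Lambda> \<inter> K\<close>
  contains at least \<open>(n\<^sub>1 + 1) \<cdots> (n\<^sub>k + 1)\<close> points of \<open>\<Lambda> \<inter> 2K\<close>, so it suffices that
  \<open>|\<Lambda> \<inter> 2K| \<le> \<Prod> 8 / \<lambda>\<^sub>i\<close>. For this, following Henk, expand lattice points in a basis
  adapted to the flag of the \<open>v\<^sub>i\<close> and reduce the \<open>i\<close>-th coordinate modulo the least power of two
  \<open>q\<^sub>i > 4 / \<lambda>\<^sub>i\<close>. As \<open>q\<^sub>j\<close> divides \<open>q\<^sub>i\<close> for \<open>i \<le> j\<close>, distinct points with equal residues
  differ by \<open>q\<^sub>j w\<close> with \<open>w \<in> \<Lambda> - span {v\<^sub>1, \<dots>, v\<^bsub>j-1\<^esub>}\<close>, hence have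
  \<open>p\<close>-distance at least \<open>q\<^sub>j \<lambda>\<^sub>j > 4\<close> and cannot both lie in \<open>2K\<close>.
\<close>

subsection \<open>The gauge of a symmetric convex body\<close>

definition gauge_norm :: "'a::euclidean_space set \<Rightarrow> 'a \<Rightarrow> real" where
  "gauge_norm K x = Inf {t. 0 < t \<and> (1 / t) *\<^sub>R x \<in> K}"

lemma mem_scaled_iff:
  fixes t :: real and x :: "'a::real_vector"
  assumes "0 < t"
  shows "x \<in> (\<lambda>y. t *\<^sub>R y) ` K \<longleftrightarrow> (1 / t) *\<^sub>R x \<in> K"
proof
  assume "(1 / t) *\<^sub>R x \<in> K"
  moreover have "t *\<^sub>R ((1 / t) *\<^sub>R x) = x" using assms by simp
  ultimately show "x \<in> (\<lambda>y. t *\<^sub>R y) ` K" by (metis image_eqI)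
qed (use assms in auto)

text \<open>With \<open>a\<close> an interior point, symmetry puts both \<open>a + x\<close> and
  \<open>- (a - x)\<close> in \<open>K\<close> for small \<open>x\<close>, and their midpoint is
  \<open>x\<close>.\<close>

lemma sym_convex_body_ball:
  assumes "sym_convex_body (K :: 'a::euclidean_space set)"
  obtains e where "0 < e" "ball 0 e \<subseteq> K"
proof -
  from assms obtain a e where a: "0 < e" "ball a e \<subseteq> K"
    unfolding sym_convex_body_def by (metis equals0I mem_interior)
  have "ball 0 e \<subseteq> K"
  proof
    fix x :: 'a assume x: "x \<in> ball 0 e"
    have "a + x \<in> K" "a - x \<in> K"
      using x by (auto intro!: subsetD[OF a(2)] simp: dist_norm)
    then have "a + x \<in> K" "- (a - x) \<in> K"
      using assms unfolding sym_convex_body_def by blast+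
    then have "(1/2) *\<^sub>R (a + x) + (1/2) *\<^sub>R (- (a - x)) \<in> K"
      using assms by (intro convexD) (auto simp: sym_convex_body_def)
    also have "(1/2) *\<^sub>R (a + x) + (1/2) *\<^sub>R (- (a - x)) = x"
      by (simp add: scaleR_right_diff_distrib scaleR_right_distrib flip: scaleR_left_distrib)
    finally show "x \<in> K" .
  qed
  with a show ?thesis using that by blast
qed

lemma sym_convex_body_shrink:
  assumes "sym_convex_body K" "x \<in> K" "\<bar>c\<bar> \<le> 1"
  shows "c *\<^sub>R x \<in> K"
proof -
  have "- x \<in> K" "convex K" using assms by (auto simp: sym_convex_body_def)
  then have "((1 + c) / 2) *\<^sub>R x + ((1 - c) / 2) *\<^sub>R (- x) \<in> K"
    using assms by (intro convexD) (auto simp: field_simps)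
  also have "((1 + c) / 2) *\<^sub>R x + ((1 - c) / 2) *\<^sub>R (- x) = c *\<^sub>R x"
    by (simp add: field_simps flip: scaleR_left_diff_distrib scaleR_left_distrib)
  finally show ?thesis .
qed

text \<open>The infimum is attained because \<open>K\<close> is closed:
  \<open>(1 / s) *\<^sub>R x\<close> lies in \<open>K\<close> for every \<open>s > t\<close>, and
  \<open>s\<close> may tend to \<open>t\<close>.\<close>

lemma gauge_norm_le_iff:
  assumes K: "sym_convex_body K" and t: "0 < t"
  shows "gauge_norm K x \<le> t \<longleftrightarrow> (1 / t) *\<^sub>R x \<in> K"
proof
  let ?S = "{t. 0 < t \<and> (1 / t) *\<^sub>R x \<in> K}"
  have bdd: "bdd_below ?S" by (rule bdd_belowI[of _ 0]) auto
  show "gauge_norm K x \<le> t" if "(1 / t) *\<^sub>R x \<in> K"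
    unfolding gauge_norm_def by (rule cInf_lower) (use that t bdd in auto)
  assume le: "gauge_norm K x \<le> t"
  obtain e where e: "0 < e" "ball 0 e \<subseteq> K" by (rule sym_convex_body_ball[OF K])
  \<comment> \<open>A large scale brings \<open>x\<close> into the ball inside \<open>K\<close>; the
    summand 1 keeps the scale positive for \<open>x = 0\<close>.\<close>
  have "(1 / (2 * norm x / e + 1)) *\<^sub>R x \<in> K"
  proof -
    have "norm ((1 / (2 * norm x / e + 1)) *\<^sub>R x) < e"
      using e by (simp add: field_simps add_pos_nonneg)
    then show ?thesis using e by auto
  qed
  moreover have "0 < 2 * norm x / e + 1" using e by (simp add: add_nonneg_pos)
  ultimately have ne: "?S \<noteq> {}" by blast
  have above: "(1 / s) *\<^sub>R x \<in> K" if "t < s" for s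
  proof -
    have "\<exists>r\<in>?S. r < s"
      using le that cInf_lessD[OF ne, of s] by (auto simp: gauge_norm_def)
    then obtain r where r: "0 < r" "(1 / r) *\<^sub>R x \<in> K" "r < s" by blast
    have "(r / s) *\<^sub>R ((1 / r) *\<^sub>R x) \<in> K"
      by (rule sym_convex_body_shrink[OF K]) (use r in auto)
    then show ?thesis using r by simp
  qed
  have "(\<lambda>n. t + inverse (real (Suc n))) \<longlonglongrightarrow> t + 0"
    by (intro tendsto_intros LIMSEQ_inverse_real_of_nat)
  then have "(\<lambda>n. (1 / (t + inverse (real (Suc n)))) *\<^sub>R x) \<longlonglongrightarrow> (1 / t) *\<^sub>R x"
    using t by (intro tendsto_intros) auto
  moreover have "closed K" using K by (auto simp: sym_convex_body_def compact_imp_closed)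
  ultimately show "(1 / t) *\<^sub>R x \<in> K"
    by (rule closed_sequentially[rotated 2]) (use above in simp)
qed

lemma gauge_norm_nonneg: "sym_convex_body K \<Longrightarrow> 0 \<le> gauge_norm K x"
proof (rule ccontr)
  assume K: "sym_convex_body K" and "\<not> 0 \<le> gauge_norm K x"
  then have neg: "gauge_norm K x < 0" by simp
  \<comment> \<open>Bounding an infimum from below needs a nonempty set. The assumed negativity
    supplies a member: a gauge below 1 makes \<open>t = 1\<close> admissible.\<close>
  have "{t. 0 < t \<and> (1 / t) *\<^sub>R x \<in> K} \<noteq> {}"
    using gauge_norm_le_iff[OF K, of 1 x] neg by (auto intro!: exI[of _ 1])
  then have "0 \<le> gauge_norm K x"
    unfolding gauge_norm_def by (rule cInf_greatest) auto
  with neg show False by simp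
qed

text \<open>This is the boundedness of \<open>K\<close>. It later gives definiteness of the gauge
  and finiteness of the lattice points of bounded gauge.\<close>

lemma gauge_norm_bound:
  assumes "sym_convex_body K"
  obtains M where "0 < M" "\<And>x. norm x \<le> M * gauge_norm K x"
proof -
  from assms have "bounded K" by (simp add: sym_convex_body_def compact_imp_bounded)
  then obtain M where M: "0 < M" "\<And>x. x \<in> K \<Longrightarrow> norm x \<le> M"
    by (meson bounded_pos)
  have le: "norm x \<le> M * t" if "gauge_norm K x \<le> t" "0 < t" for x t
    using M(2)[of "(1 / t) *\<^sub>R x"] gauge_norm_le_iff[OF assms] that by (simp add: field_simps)
  have "norm x \<le> M * gauge_norm K x" for x
  proof (rule field_le_epsilon)
    fix e :: real assume "0 < e"
    then have "norm x \<le> M * (gauge_norm K x + e / M)"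
      using M(1) gauge_norm_nonneg[OF assms, of x] by (intro le) (auto intro: add_nonneg_pos)
    then show "norm x \<le> M * gauge_norm K x + e" using M(1) by (simp add: distrib_left)
  qed
  with M that show ?thesis by blast
qed

lemma gauge_norm_triangle:
  assumes K: "sym_convex_body K"
  shows "gauge_norm K (x + y) \<le> gauge_norm K x + gauge_norm K y"
proof (rule field_le_epsilon)
  fix e :: real assume e: "0 < e"
  \<comment> \<open>The slack makes \<open>s\<close> and \<open>t\<close> positive, so that
    \<open>(x + y) / (s + t)\<close> is a convex combination of \<open>x / s\<close> and
    \<open>y / t\<close>.\<close>
  define s t where "s = gauge_norm K x + e / 2" "t = gauge_norm K y + e / 2"
  have st: "0 < s" "0 < t" using gauge_norm_nonneg[OF K] e by (simp_all add: s_t_def add_nonneg_pos)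
  have "(1 / s) *\<^sub>R x \<in> K" "(1 / t) *\<^sub>R y \<in> K"
    using gauge_norm_le_iff[OF K st(1), of x] gauge_norm_le_iff[OF K st(2), of y] e
    by (simp_all add: s_t_def)
  then have "(s / (s + t)) *\<^sub>R ((1 / s) *\<^sub>R x) + (t / (s + t)) *\<^sub>R ((1 / t) *\<^sub>R y) \<in> K"
    using K st by (intro convexD) (auto simp: sym_convex_body_def simp flip: add_divide_distrib)
  then have "(1 / (s + t)) *\<^sub>R (x + y) \<in> K"
    using st by (simp add: scaleR_right_distrib)
  then have "gauge_norm K (x + y) \<le> s + t"
    using gauge_norm_le_iff[OF K] st by simp
  then show "gauge_norm K (x + y) \<le> gauge_norm K x + gauge_norm K y + e"
    by (simp add: s_t_def)
qed

lemma gauge_norm_scale: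
  assumes K: "sym_convex_body K"
  shows "gauge_norm K (c *\<^sub>R x) = \<bar>c\<bar> * gauge_norm K x"
proof (cases "c = 0")
  case True
  obtain r where "0 < r" "ball 0 r \<subseteq> K" by (rule sym_convex_body_ball[OF K])
  then have "0 \<in> K" by auto
  then have "gauge_norm K 0 \<le> e" if "0 < e" for e
    using gauge_norm_le_iff[OF K that, of 0] by simp
  then have "gauge_norm K 0 \<le> 0" using field_le_epsilon[of "gauge_norm K 0" 0] by simp
  then show ?thesis using True gauge_norm_nonneg[OF K, of 0] by simp
next
  case c: False
  have minus: "- z \<in> K \<longleftrightarrow> z \<in> K" for z
    using sym_convex_body_shrink[OF K, of z "-1"] sym_convex_body_shrink[OF K, of "- z" "-1"] by auto
  \<comment> \<open>Membership in \<open>K\<close> describes only positive bounds \<open>t\<close>,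
    so the two sides are compared through these, and equality follows by letting a slack
    \<open>e\<close> tend to 0.\<close>
  have *: "gauge_norm K (c *\<^sub>R x) \<le> t \<longleftrightarrow> \<bar>c\<bar> * gauge_norm K x \<le> t" if t: "0 < t" for t
  proof -
    have "gauge_norm K (c *\<^sub>R x) \<le> t \<longleftrightarrow> (c / t) *\<^sub>R x \<in> K"
      using gauge_norm_le_iff[OF K t] by simp
    also have "\<dots> \<longleftrightarrow> (\<bar>c\<bar> / t) *\<^sub>R x \<in> K"
      using minus[of "(c / t) *\<^sub>R x"] by (cases "c < 0") simp_all
    also have "\<dots> \<longleftrightarrow> gauge_norm K x \<le> t / \<bar>c\<bar>"
      using gauge_norm_le_iff[OF K, of "t / \<bar>c\<bar>" x] t c by simp
    finally show ?thesis using c by (simp add: field_simps)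
  qed
  have nn: "0 \<le> \<bar>c\<bar> * gauge_norm K x" "0 \<le> gauge_norm K (c *\<^sub>R x)"
    using gauge_norm_nonneg[OF K] by simp_all
  show ?thesis
  proof (rule antisym; rule field_le_epsilon)
    fix e :: real assume "0 < e"
    then show "gauge_norm K (c *\<^sub>R x) \<le> \<bar>c\<bar> * gauge_norm K x + e"
      using *[of "\<bar>c\<bar> * gauge_norm K x + e"] nn(1) by linarith
  next
    fix e :: real assume "0 < e"
    then show "\<bar>c\<bar> * gauge_norm K x \<le> gauge_norm K (c *\<^sub>R x) + e"
      using *[of "gauge_norm K (c *\<^sub>R x) + e"] nn(2) by linarith
  qed
qed

subsection \<open>Lattices\<close>

lemma lattice_zero:
  assumes "is_lattice L"
  shows "0 \<in> L"
proof -
  obtain B where L: "L = {(\<Sum>b\<in>B. of_int (f b) *\<^sub>R b) | f. True}"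
    using assms by (auto simp: is_lattice_def)
  show ?thesis
    unfolding L by (intro CollectI exI[of _ "\<lambda>_. 0"]) simp
qed

lemma lattice_diff:
  assumes "is_lattice L" "x \<in> L" "y \<in> L"
  shows "x - y \<in> L"
proof -
  obtain B where L: "L = {(\<Sum>b\<in>B. of_int (f b) *\<^sub>R b) | f. True}"
    using assms by (auto simp: is_lattice_def)
  then obtain f g where "x = (\<Sum>b\<in>B. of_int (f b) *\<^sub>R b)" "y = (\<Sum>b\<in>B. of_int (g b) *\<^sub>R b)"
    using assms by auto
  then have "x - y = (\<Sum>b\<in>B. of_int (f b - g b) *\<^sub>R b)"
    by (simp add: sum_subtractf scaleR_left_diff_distrib)
  then show ?thesis
    unfolding L by (intro CollectI exI[of _ "\<lambda>b. f b - g b"]) simp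
qed

lemma lattice_span:
  fixes L :: "'a::euclidean_space set"
  assumes "is_lattice L"
  shows "span L = UNIV"
proof -
  obtain B where B: "finite B" "independent B" "card B = DIM('a)"
    and L: "L = {(\<Sum>b\<in>B. of_int (f b) *\<^sub>R b) | f. True}"
    using assms by (auto simp: is_lattice_def)
  have "B \<subseteq> L"
  proof
    fix b assume b: "b \<in> B"
    have "b = (\<Sum>c\<in>B. of_int (if c = b then 1 else 0) *\<^sub>R c)"
      using B b by (simp add: if_distrib if_distribR sum.delta cong: if_cong)
    then show "b \<in> L"
      unfolding L by (intro CollectI exI[of _ "\<lambda>c. if c = b then 1 else 0"]) simp
  qed
  moreover have "span B = UNIV"
    using B by (metis dim_eq_full dim_eq_card_independent)
  ultimately show ?thesis by (metis span_mono top.extremum_uniqueI)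
qed

text \<open>The coordinates with respect to the basis are linear functionals \<open>g b\<close>,
  hence bounded by multiples of the norm. A bounded set thus admits only finitely many integer
  coordinate vectors.\<close>

lemma lattice_finite_bounded:
  fixes L :: "'a::euclidean_space set"
  assumes "is_lattice L"
  shows "finite {x \<in> L. norm x \<le> r}"
proof -
  obtain B where B: "finite B" "independent B"
    and L: "L = {(\<Sum>b\<in>B. of_int (f b) *\<^sub>R b) | f. True}"
    using assms by (auto simp: is_lattice_def)
  have "\<exists>g::'a \<Rightarrow> real. linear g \<and> (\<forall>c\<in>B. g c = (if c = b then 1 else 0))" for b
    using B by (intro linear_independent_extend)
  then obtain g :: "'a \<Rightarrow> 'a \<Rightarrow> real"
    where g: "\<And>b. linear (g b)" "\<And>b c. c \<in> B \<Longrightarrow> g b c = (if c = b then 1 else 0)"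
    by metis
  have "\<exists>C. \<forall>x. norm (g b x) \<le> C * norm x" for b
    using linear_bounded[OF g(1)] .
  then obtain C where C: "\<And>b x. norm (g b x) \<le> C b * norm x" by metis
  have C0: "0 \<le> C b" if "b \<in> B" for b
  proof -
    from C[of b b] g(2)[OF that, of b] have "1 \<le> C b * norm b" by simp
    then show ?thesis by (smt (verit) mult_nonpos_nonneg norm_ge_zero)
  qed
  define N where "N b = \<lceil>C b * r\<rceil>" for b
  have "{x \<in> L. norm x \<le> r} \<subseteq>
      (\<lambda>f. \<Sum>b\<in>B. of_int (f b) *\<^sub>R b) ` (\<Pi>\<^sub>E b\<in>B. {- N b..N b})"
  proof
    fix x assume "x \<in> {x \<in> L. norm x \<le> r}"
    then obtain f where f: "x = (\<Sum>b\<in>B. of_int (f b) *\<^sub>R b)" and x: "norm x \<le> r"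
      by (auto simp: L)
    have "f b \<in> {- N b..N b}" if b: "b \<in> B" for b
    proof -
      have "g b x = (\<Sum>c\<in>B. of_int (f c) * g b c)"
        using g(1) by (simp add: f linear_sum linear_cmul)
      also have "\<dots> = (\<Sum>c\<in>B. if c = b then of_int (f c) else 0)"
        using g(2) by (intro sum.cong) auto
      also have "\<dots> = of_int (f b)" using B b by simp
      finally have "\<bar>of_int (f b)\<bar> \<le> C b * norm x" using C[of b x] by simp
      also have "\<dots> \<le> C b * r" using x C0[OF b] by (intro mult_left_mono) auto
      also have "\<dots> \<le> of_int (N b)" by (simp add: N_def)
      finally have "\<bar>f b\<bar> \<le> N b" by linarith
      then show ?thesis by auto
    qed
    then have "restrict f B \<in> (\<Pi>\<^sub>E b\<in>B. {- N b..N b})" by auto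
    moreover have "x = (\<Sum>b\<in>B. of_int (restrict f B b) *\<^sub>R b)" by (simp add: f)
    ultimately show "x \<in> (\<lambda>f. \<Sum>b\<in>B. of_int (f b) *\<^sub>R b) ` (\<Pi>\<^sub>E b\<in>B. {- N b..N b})"
      by blast
  qed
  then show ?thesis
    by (rule finite_subset) (intro finite_imageI finite_PiE B; simp)
qed

lemma independent_sequence:
  fixes v :: "nat \<Rightarrow> 'a::real_vector"
  assumes "\<And>i. i \<in> {1..n} \<Longrightarrow> v i \<notin> span (v ` {1..<i})"
  shows "independent (v ` {1..n}) \<and> inj_on v {1..n}"
  using assms
proof (induction n)
  case 0
  then show ?case by (simp add: independent_empty)
next
  case (Suc n)
  have IH: "independent (v ` {1..n})" "inj_on v {1..n}"
    using Suc by (auto simp: atLeastAtMostSuc_conv)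
  have new: "v (Suc n) \<notin> span (v ` {1..n})"
    using Suc.prems[of "Suc n"] by (simp add: atLeastLessThanSuc_atLeastAtMost)
  then have notin: "v (Suc n) \<notin> v ` {1..n}" by (rule contrapos_nn) (rule span_base)
  have ins: "{1..Suc n} = insert (Suc n) {1..n}" by auto
  show ?case
    unfolding ins image_insert inj_on_insert using IH notin independent_insertI[OF new IH(1)]
    by auto
qed

section \<open>Discrete spanning subgroups with a norm\<close>

locale lattice_norm =
  fixes L :: "'a::euclidean_space set" and p :: "'a \<Rightarrow> real"
  assumes zero_mem: "0 \<in> L"
    and diff_mem: "x \<in> L \<Longrightarrow> y \<in> L \<Longrightarrow> x - y \<in> L"
    and span_lattice: "span L = UNIV"
    and triangle: "p (x + y) \<le> p x + p y"
    and scale: "p (c *\<^sub>R x) = \<bar>c\<bar> * p x"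
    and pos: "x \<noteq> 0 \<Longrightarrow> 0 < p x"
    and finite_le: "finite {x \<in> L. p x \<le> r}"
begin

lemma p_zero [simp]: "p 0 = 0"
  using scale[of 0 0] by simp

lemma p_nonneg: "0 \<le> p x"
  using pos[of x] by (cases "x = 0") auto

lemma p_diff: "p (x - y) \<le> p x + p y"
  using triangle[of x "- y"] scale[of "-1" y] by simp

lemma p_sum: "p (\<Sum>i\<in>A. f i) \<le> (\<Sum>i\<in>A. p (f i))"
proof (induction A rule: infinite_finite_induct)
  case (insert x A)
  then show ?case using triangle[of "f x" "sum f A"] by simp
qed auto

lemma add_mem: "x \<in> L \<Longrightarrow> y \<in> L \<Longrightarrow> x + y \<in> L"
  using diff_mem[of x "0 - y"] diff_mem[of 0 y] zero_mem by simp

lemma nat_scale_mem: "x \<in> L \<Longrightarrow> real n *\<^sub>R x \<in> L"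
  by (induction n) (simp_all add: zero_mem add_mem scaleR_left_distrib)

lemma int_scale_mem:
  assumes "x \<in> L"
  shows "of_int m *\<^sub>R x \<in> L"
proof (cases m rule: int_cases2)
  case (nonneg n)
  then show ?thesis using nat_scale_mem[OF assms] by simp
next
  case (nonpos n)
  then show ?thesis using diff_mem[OF zero_mem nat_scale_mem[OF assms, of n]] by simp
qed

lemma sum_mem: "(\<And>i. i \<in> A \<Longrightarrow> f i \<in> L) \<Longrightarrow> (\<Sum>i\<in>A. f i) \<in> L"
  by (induction A rule: infinite_finite_induct) (auto simp: zero_mem add_mem)

text \<open>Rounding down the coefficients of \<open>u\<close> leaves a remainder with coefficients
  in [0, 1).\<close>

lemma round_to_lattice:
  assumes "finite T" "T \<subseteq> L" "u \<in> span T"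
  obtains w where "w \<in> L" "w \<in> span T" "p (u - w) \<le> (\<Sum>b\<in>T. p b)"
proof -
  obtain c where u: "u = (\<Sum>b\<in>T. c b *\<^sub>R b)"
    using assms by (auto simp: span_finite)
  define w where "w = (\<Sum>b\<in>T. of_int \<lfloor>c b\<rfloor> *\<^sub>R b)"
  have "u - w = (\<Sum>b\<in>T. frac (c b) *\<^sub>R b)"
    by (simp add: u w_def frac_def scaleR_left_diff_distrib sum_subtractf)
  then have "p (u - w) \<le> (\<Sum>b\<in>T. frac (c b) * p b)"
    using p_sum[of "\<lambda>b. frac (c b) *\<^sub>R b" T] by (simp add: scale)
  also have "\<dots> \<le> (\<Sum>b\<in>T. p b)"
    using p_nonneg frac_lt_1[THEN less_imp_le] by (intro sum_mono mult_left_le_one_le) auto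
  finally have "p (u - w) \<le> (\<Sum>b\<in>T. p b)" .
  moreover have "w \<in> L" using assms by (auto simp: w_def intro!: sum_mem int_scale_mem)
  moreover have "w \<in> span T" unfolding w_def by (intro span_sum span_scale span_base)
  ultimately show ?thesis using that by blast
qed

text \<open>Modulo \<open>span T\<close> the lattice points of \<open>span (insert a T)\<close> are
  described by their coefficient of \<open>a\<close>. The coefficients in (0, 1] form a finite set
  \<open>H\<close>; a lattice point \<open>b\<close> with the least of them generates all others, as
  division with remainder shows.\<close>

lemma generator_modulo_span:
  assumes T: "finite T" "T \<subseteq> L" and a: "a \<in> L" "a \<notin> span T"
  obtains b where "b \<in> L" "b \<in> span (insert a T)" "b \<notin> span T"
    "\<And>x. x \<in> L \<Longrightarrow> x \<in> span (insert a T) \<Longrightarrow> \<exists>m. x - of_int m *\<^sub>R b \<in> span T"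
proof -
  define H where "H = {t. 0 < t \<and> t \<le> 1 \<and> (\<exists>x\<in>L. x - t *\<^sub>R a \<in> span T)}"
  define Z where "Z = {x \<in> L. p x \<le> p a + (\<Sum>b\<in>T. p b)}"
  have unique: "s = t" if "x - s *\<^sub>R a \<in> span T" "x - t *\<^sub>R a \<in> span T" for s t x
  proof (rule ccontr)
    assume "s \<noteq> t"
    have "(x - s *\<^sub>R a) - (x - t *\<^sub>R a) = (t - s) *\<^sub>R a"
      by (simp add: scaleR_left_diff_distrib)
    then have "(t - s) *\<^sub>R a \<in> span T" using span_diff[OF that] by simp
    then have "inverse (t - s) *\<^sub>R ((t - s) *\<^sub>R a) \<in> span T" by (rule span_scale)
    with \<open>s \<noteq> t\<close> a show False by simp
  qed
  \<comment> \<open>Subtracting a lattice point of \<open>span T\<close> does not change the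
    coefficient of \<open>a\<close>, so by rounding each member of \<open>H\<close> comes from a
    point of the finite set \<open>Z\<close>.\<close>
  have "H \<subseteq> (\<lambda>x. THE t. x - t *\<^sub>R a \<in> span T) ` Z"
  proof
    fix t assume "t \<in> H"
    then obtain x where x: "0 < t" "t \<le> 1" "x \<in> L" "x - t *\<^sub>R a \<in> span T"
      by (auto simp: H_def)
    obtain w where w: "w \<in> L" "w \<in> span T" "p (x - t *\<^sub>R a - w) \<le> (\<Sum>b\<in>T. p b)"
      using round_to_lattice[OF T x(4)] by blast
    have "(x - w) - t *\<^sub>R a \<in> span T"
      using span_diff[OF x(4) w(2)] by (simp add: algebra_simps)
    then have "t = (THE t. (x - w) - t *\<^sub>R a \<in> span T)"
      using unique by (intro the_equality[symmetric]) auto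
    moreover have "p (x - w) \<le> p (x - t *\<^sub>R a - w) + p (t *\<^sub>R a)"
      using triangle[of "x - t *\<^sub>R a - w" "t *\<^sub>R a"] by (simp add: algebra_simps)
    then have "p (x - w) \<le> p a + (\<Sum>b\<in>T. p b)"
      using w(3) x p_nonneg[of a] mult_left_le_one_le[of "p a" t] by (simp add: scale)
    then have "x - w \<in> Z" using x w diff_mem by (simp add: Z_def)
    ultimately show "t \<in> (\<lambda>x. THE t. x - t *\<^sub>R a \<in> span T) ` Z" by blast
  qed
  then have finH: "finite H" by (rule finite_subset) (simp add: Z_def finite_le)
  have "1 \<in> H" using a by (auto simp: H_def intro!: bexI[of _ a] span_zero)
  define t0 where "t0 = Min H"
  have "t0 \<in> H" using finH \<open>1 \<in> H\<close> by (auto simp: t0_def intro!: Min_in)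
  then obtain b where b: "0 < t0" "t0 \<le> 1" "b \<in> L" "b - t0 *\<^sub>R a \<in> span T"
    by (auto simp: H_def)
  show ?thesis
  proof (rule that[OF b(3)])
    show "b \<in> span (insert a T)" using b by (auto simp: span_breakdown_eq)
    show "b \<notin> span T"
      using unique[of b t0 0] b by auto
    fix x assume x: "x \<in> L" "x \<in> span (insert a T)"
    then obtain k where k: "x - k *\<^sub>R a \<in> span T" by (auto simp: span_breakdown_eq)
    \<comment> \<open>The remainder \<open>s\<close> of \<open>k\<close> modulo \<open>t0\<close> is
      again a coefficient of a lattice point; were it nonzero, it would lie in \<open>H\<close>
      below the minimum.\<close>
    define m where "m = \<lfloor>k / t0\<rfloor>"
    define s where "s = k - of_int m * t0"
    have "of_int m \<le> k / t0" "k / t0 < of_int m + 1" by (simp_all add: m_def)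
    then have s: "0 \<le> s" "s < t0" using b by (simp_all add: s_def field_simps)
    have eq: "(x - of_int m *\<^sub>R b) - s *\<^sub>R a = (x - k *\<^sub>R a) - of_int m *\<^sub>R (b - t0 *\<^sub>R a)"
      by (simp add: s_def algebra_simps)
    have mem: "(x - of_int m *\<^sub>R b) - s *\<^sub>R a \<in> span T"
      unfolding eq by (intro span_diff span_scale k b)
    have "s = 0"
    proof (rule ccontr)
      assume "s \<noteq> 0"
      then have "s \<in> H"
        using s b mem diff_mem[OF x(1) int_scale_mem[OF b(3)]] by (auto simp: H_def)
      then show False using s Min_le[OF finH] by (fastforce simp: t0_def)
    qed
    with mem show "\<exists>m. x - of_int m *\<^sub>R b \<in> span T" by auto
  qed
qed

lemma successive_minimizers:
  "n \<le> DIM('a) \<Longrightarrow> \<exists>v. \<forall>i\<in>{1..n}. v i \<in> L \<and> v i \<notin> span (v ` {1..<i}) \<and>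
     (\<forall>x\<in>L. x \<notin> span (v ` {1..<i}) \<longrightarrow> p (v i) \<le> p x)"
proof (induction n)
  case 0
  then show ?case by simp
next
  case (Suc n)
  then obtain v where v: "\<forall>i\<in>{1..n}. v i \<in> L \<and> v i \<notin> span (v ` {1..<i}) \<and>
     (\<forall>x\<in>L. x \<notin> span (v ` {1..<i}) \<longrightarrow> p (v i) \<le> p x)" by auto
  let ?W = "span (v ` {1..n})"
  have "dim (v ` {1..n}) \<le> n"
    using dim_le_card'[of "v ` {1..n}"] card_image_le[of "{1..n}" v] by simp
  then have "?W \<noteq> UNIV" using Suc.prems by (auto simp: dim_eq_full[symmetric])
  then obtain x where x: "x \<in> L" "x \<notin> ?W"
    using span_lattice span_minimal[of L ?W] by auto
  \<comment> \<open>Cutting off at \<open>p x\<close> makes the set finite; a minimizer on it is a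
    minimizer on all of \<open>L - ?W\<close>, since points beyond the cut exceed
    \<open>p x\<close>.\<close>
  define Y where "Y = {y \<in> L. p y \<le> p x} - ?W"
  have Y: "finite Y" "x \<in> Y" using x finite_le by (auto simp: Y_def)
  define w where "w = arg_min_on p Y"
  have w: "w \<in> Y" "\<And>y. y \<in> Y \<Longrightarrow> p w \<le> p y"
    using Y arg_min_if_finite(1)[of Y p] arg_min_least[of Y _ p] by (auto simp: w_def)
  have wmin: "p w \<le> p y" if "y \<in> L" "y \<notin> ?W" for y
    using w(2)[of y] w(2)[OF Y(2)] that by (cases "p y \<le> p x") (auto simp: Y_def)
  define v' where "v' = v(Suc n := w)"
  have im: "v' ` {1..<i} = v ` {1..<i}" if "i \<le> Suc n" for i
    using that by (auto simp: v'_def)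
  have "v' i \<in> L \<and> v' i \<notin> span (v' ` {1..<i}) \<and>
     (\<forall>x\<in>L. x \<notin> span (v' ` {1..<i}) \<longrightarrow> p (v' i) \<le> p x)" if i: "i \<in> {1..Suc n}" for i
  proof (cases "i = Suc n")
    case True
    then show ?thesis using w(1) wmin im[of i]
      by (auto simp: v'_def Y_def atLeastLessThanSuc_atLeastAtMost)
  next
    case False
    then show ?thesis using v i im[of i] by (auto simp: v'_def)
  qed
  then show ?case by blast
qed

end

subsection \<open>Counting lattice points\<close>

text \<open>The vectors \<open>v i\<close> span the space but may generate only a proper subgroup of
  \<open>L\<close>. Hence the count below takes generators modulo the spans of initial segments
  instead of coordinates in \<open>v\<close>.\<close>

locale minimal_system = lattice_norm L p
  for L :: "'a::euclidean_space set" and p :: "'a \<Rightarrow> real" +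
  fixes v :: "nat \<Rightarrow> 'a"
  assumes v_mem: "i \<in> {1..DIM('a)} \<Longrightarrow> v i \<in> L"
    and v_new: "i \<in> {1..DIM('a)} \<Longrightarrow> v i \<notin> span (v ` {1..<i})"
    and v_min: "i \<in> {1..DIM('a)} \<Longrightarrow> x \<in> L \<Longrightarrow> x \<notin> span (v ` {1..<i}) \<Longrightarrow> p (v i) \<le> p x"
begin

lemma v_independent: "independent (v ` {1..DIM('a)})"
  and v_inj: "inj_on v {1..DIM('a)}"
  using independent_sequence[of "DIM('a)" v, OF v_new] by simp_all

lemma v_span: "span (v ` {1..DIM('a)}) = UNIV"
proof -
  have "dim (v ` {1..DIM('a)}) = DIM('a)"
    using card_image[OF v_inj] dim_eq_card_independent[OF v_independent] by simp
  then show ?thesis by (simp only: dim_eq_full)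
qed

lemma v_pos: "i \<in> {1..DIM('a)} \<Longrightarrow> 0 < p (v i)"
proof (rule pos)
  assume "i \<in> {1..DIM('a)}"
  then show "v i \<noteq> 0" using v_new[of i] span_zero[of "v ` {1..<i}"] by auto
qed

lemma v_mono:
  assumes "1 \<le> i" "i \<le> j" "j \<le> DIM('a)"
  shows "p (v i) \<le> p (v j)"
proof -
  have "span (v ` {1..<i}) \<subseteq> span (v ` {1..<j})"
    using assms by (intro span_mono image_mono) auto
  then show ?thesis using assms v_new[of j] v_mem[of j] by (intro v_min) auto
qed

lemma sum_v_eq:
  assumes "T \<subseteq> {1..DIM('a)}" "(\<Sum>i\<in>T. f i *\<^sub>R v i) = (\<Sum>i\<in>T. g i *\<^sub>R v i)" "i \<in> T"
  shows "f i = g i"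
proof -
  have inj: "inj_on v T" using v_inj assms inj_on_subset by blast
  have fin: "finite T" using assms finite_subset by blast
  define h where "h x = f (inv_into T v x) - g (inv_into T v x)" for x
  have "(\<Sum>x\<in>v ` T. h x *\<^sub>R x) = (\<Sum>i\<in>T. (f i - g i) *\<^sub>R v i)"
    using inj by (simp add: sum.reindex h_def)
  also have "\<dots> = 0" using assms by (simp add: scaleR_left_diff_distrib sum_subtractf)
  finally have "h (v i) = 0"
    using assms fin by (intro independentD[OF v_independent, of "v ` T" h]) auto
  then show ?thesis using inj assms by (simp add: h_def)
qed

text \<open>
  The colour of \<open>x\<close> encodes its residues. The clause on common divisors \<open>r\<close> only serves the
  induction on \<open>n\<close>, where it lets \<open>q (n + 1)\<close> be factored out of the lower part of \<open>x - y\<close>.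
\<close>
definition separating :: "(nat \<Rightarrow> nat) \<Rightarrow> nat \<Rightarrow> ('a \<Rightarrow> nat) \<Rightarrow> bool" where
  "separating q n c \<longleftrightarrow>
    (\<forall>x \<in> L \<inter> span (v ` {1..n}). c x < (\<Prod>j\<in>{1..n}. q j)) \<and>
    (\<forall>x \<in> L \<inter> span (v ` {1..n}). \<forall>y \<in> L \<inter> span (v ` {1..n}). c x = c y \<longrightarrow>
       (\<forall>r. (\<forall>j\<in>{1..n}. r dvd q j) \<longrightarrow> (\<exists>w\<in>L. x - y = real r *\<^sub>R w)) \<and>
       (x = y \<or> (\<exists>j\<in>{1..n}. \<exists>w\<in>L. w \<notin> span (v ` {1..<j}) \<and> x - y = real (q j) *\<^sub>R w)))"

text \<open>Each step adds one coordinate, with respect to a generator \<open>b\<close> modulo the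
  previous span, and records it modulo \<open>q (Suc n)\<close>.\<close>

lemma separating_colouring:
  fixes q :: "nat \<Rightarrow> nat"
  assumes q_pos: "\<And>i. i \<in> {1..DIM('a)} \<Longrightarrow> 0 < q i"
    and q_dvd: "\<And>i j. 1 \<le> i \<Longrightarrow> i \<le> j \<Longrightarrow> j \<le> DIM('a) \<Longrightarrow> q j dvd q i"
  shows "n \<le> DIM('a) \<Longrightarrow> \<exists>c. separating q n c"
proof (induction n)
  case 0
  then show ?case using zero_mem
    by (auto simp: separating_def intro!: exI[of _ "\<lambda>_. 0"] bexI[of _ 0])
next
  case (Suc n)
  let ?V = "L \<inter> span (v ` {1..n})" and ?W = "L \<inter> span (v ` {1..Suc n})"
  let ?Q = "\<Prod>j\<in>{1..n}. q j"
  obtain c :: "'a \<Rightarrow> nat" where c: "\<And>x. x \<in> ?V \<Longrightarrow> c x < ?Q"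
    and c1: "\<And>x y r. x \<in> ?V \<Longrightarrow> y \<in> ?V \<Longrightarrow> c x = c y \<Longrightarrow> \<forall>j\<in>{1..n}. r dvd q j \<Longrightarrow>
               \<exists>w\<in>L. x - y = real r *\<^sub>R w"
    and c2: "\<And>x y. x \<in> ?V \<Longrightarrow> y \<in> ?V \<Longrightarrow> c x = c y \<Longrightarrow> x \<noteq> y \<Longrightarrow>
               \<exists>j\<in>{1..n}. \<exists>w\<in>L. w \<notin> span (v ` {1..<j}) \<and> x - y = real (q j) *\<^sub>R w"
    using Suc.IH[OF Suc_leD[OF Suc.prems]] unfolding separating_def by blast
  have N: "Suc n \<in> {1..DIM('a)}" using Suc.prems by simp
  have T: "v ` {1..Suc n} = insert (v (Suc n)) (v ` {1..n})"
    by (simp add: atLeastAtMostSuc_conv)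
  have sub: "v ` {1..n} \<subseteq> L" using v_mem Suc.prems by auto
  have new: "v (Suc n) \<notin> span (v ` {1..n})"
    using v_new[OF N] by (simp add: atLeastLessThanSuc_atLeastAtMost)
  obtain b where b: "b \<in> L" "b \<in> span (v ` {1..Suc n})" "b \<notin> span (v ` {1..n})"
    and bm: "\<And>x. x \<in> L \<Longrightarrow> x \<in> span (v ` {1..Suc n}) \<Longrightarrow>
      \<exists>m. x - of_int m *\<^sub>R b \<in> span (v ` {1..n})"
    by (rule generator_modulo_span[OF _ sub v_mem[OF N] new, folded T]) auto
  \<comment> \<open>Fixing one integer coordinate per point makes the remainder
    \<open>rest x\<close> a function of \<open>x\<close>, to which the earlier colouring
    applies.\<close>
  define m where "m x = (SOME m. x - of_int m *\<^sub>R b \<in> span (v ` {1..n}))" for x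
  have m: "x - of_int (m x) *\<^sub>R b \<in> span (v ` {1..n})" if "x \<in> ?W" for x
    unfolding m_def using that by (intro someI_ex[OF bm]) auto
  define rest where "rest x = x - of_int (m x) *\<^sub>R b" for x
  have rest: "rest x \<in> ?V" if "x \<in> ?W" for x
    using m[OF that] that b by (auto simp: rest_def intro!: diff_mem int_scale_mem)
  let ?q = "q (Suc n)"
  have q: "0 < ?q" using q_pos N by blast
  \<comment> \<open>Mixed radix: the new residue is the leading digit and the old colour, which is
    below \<open>?Q\<close>, the trailing one. Both can be recovered from
    \<open>c' x\<close>.\<close>
  define c' where "c' x = nat (m x mod int ?q) * ?Q + c (rest x)" for x
  have digit: "nat (m x mod int ?q) < ?q" for x
    using q by (simp add: nat_less_iff)
  have bound: "c' x < (\<Prod>j\<in>{1..Suc n}. q j)" if "x \<in> ?W" for x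
  proof -
    have "c' x < (nat (m x mod int ?q) + 1) * ?Q"
      using c[OF rest[OF that]] by (simp add: c'_def)
    also have "\<dots> \<le> ?q * ?Q" using digit[of x] by (intro mult_right_mono) auto
    finally show ?thesis by (simp add: atLeastAtMostSuc_conv)
  qed
  have sep: "(\<forall>r. (\<forall>j\<in>{1..Suc n}. r dvd q j) \<longrightarrow> (\<exists>w\<in>L. x - y = real r *\<^sub>R w)) \<and>
      (x = y \<or> (\<exists>j\<in>{1..Suc n}. \<exists>w\<in>L. w \<notin> span (v ` {1..<j}) \<and> x - y = real (q j) *\<^sub>R w))"
    if xy: "x \<in> ?W" "y \<in> ?W" and eq: "c' x = c' y" for x y
  proof -
    have r: "rest x \<in> ?V" "rest y \<in> ?V" using rest xy by blast+
    have digits: "(a * Q + b) div Q = a" "(a * Q + b) mod Q = b" if "b < Q" for a b Q :: nat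
      using that by (cases "Q = 0"; simp)+
    have "c' x mod ?Q = c (rest x)" "c' y mod ?Q = c (rest y)"
      "c' x div ?Q = nat (m x mod int ?q)" "c' y div ?Q = nat (m y mod int ?q)"
      unfolding c'_def by (rule digits[OF c[OF r(1)]] digits[OF c[OF r(2)]])+
    with eq have ceq: "c (rest x) = c (rest y)" and "nat (m x mod int ?q) = nat (m y mod int ?q)"
      by simp_all
    then have "m x mod int ?q = m y mod int ?q"
      using q by (simp add: eq_nat_nat_iff)
    then obtain m' where m': "m x - m y = int ?q * m'"
      by (metis dvdE mod_eq_dvd_iff)
    \<comment> \<open>The divisor clause of the induction hypothesis is used here with
      \<open>r = ?q\<close>.\<close>
    have "\<forall>j\<in>{1..n}. ?q dvd q j" using q_dvd N by auto
    then obtain w where w: "w \<in> L" "rest x - rest y = real ?q *\<^sub>R w"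
      using c1[OF r ceq] by blast
    have "x - y = of_int (m x - m y) *\<^sub>R b + (rest x - rest y)"
      by (simp add: rest_def algebra_simps)
    also have "\<dots> = real ?q *\<^sub>R (of_int m' *\<^sub>R b + w)"
      by (simp add: m' w scaleR_right_distrib)
    finally have z: "x - y = real ?q *\<^sub>R (of_int m' *\<^sub>R b + w)" .
    have wL: "of_int m' *\<^sub>R b + w \<in> L" using b w by (intro add_mem int_scale_mem)
    have "\<exists>w\<in>L. x - y = real r *\<^sub>R w" if dvd: "\<forall>j\<in>{1..Suc n}. r dvd q j" for r
    proof -
      from dvd obtain e where "?q = r * e" by fastforce
      then have "x - y = real r *\<^sub>R (real e *\<^sub>R (of_int m' *\<^sub>R b + w))" by (simp add: z)
      then show ?thesis using nat_scale_mem[OF wL] by blast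
    qed
    moreover have "x = y \<or> (\<exists>j\<in>{1..Suc n}. \<exists>w\<in>L. w \<notin> span (v ` {1..<j}) \<and>
        x - y = real (q j) *\<^sub>R w)"
    proof (cases "m' = 0")
      case True
      then have "x - y = rest x - rest y" using z w by simp
      then show ?thesis using c2[OF r ceq]
        by (metis atLeastAtMost_iff le_SucI eq_iff_diff_eq_0)
    next
      \<comment> \<open>The new coordinates differ, so the index \<open>Suc n\<close> serves:
        \<open>b\<close> occurs in \<open>of_int m' *\<^sub>R b + w\<close> with nonzero coefficient
        while \<open>w\<close> stays in the old span.\<close>
      case False
      have "w \<in> span (v ` {1..n})"
      proof -
        have "inverse (real ?q) *\<^sub>R (rest x - rest y) \<in> span (v ` {1..n})"
          using r by (intro span_scale span_diff) auto
        then show ?thesis using w q by simp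
      qed
      have "of_int m' *\<^sub>R b + w \<notin> span (v ` {1..n})"
      proof
        assume "of_int m' *\<^sub>R b + w \<in> span (v ` {1..n})"
        then have "inverse (of_int m') *\<^sub>R ((of_int m' *\<^sub>R b + w) - w) \<in> span (v ` {1..n})"
          using \<open>w \<in> span _\<close> by (intro span_scale span_diff)
        with b False show False by simp
      qed
      then show ?thesis using z wL
        by (intro disjI2 bexI[of _ "Suc n"] bexI[of _ "of_int m' *\<^sub>R b + w"])
           (auto simp: atLeastLessThanSuc_atLeastAtMost)
    qed
    ultimately show ?thesis by blast
  qed
  have "separating q (Suc n) c'"
    unfolding separating_def using bound sep by blast
  then show ?case by blast
qed

lemma card_le_prod:
  fixes q :: "nat \<Rightarrow> nat"
  assumes q_dvd: "\<And>i j. 1 \<le> i \<Longrightarrow> i \<le> j \<Longrightarrow> j \<le> DIM('a) \<Longrightarrow> q j dvd q i"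
    and q_large: "\<And>i. i \<in> {1..DIM('a)} \<Longrightarrow> 2 * r < real (q i) * p (v i)"
    and "0 \<le> r"
  shows "card {x \<in> L. p x \<le> r} \<le> (\<Prod>j\<in>{1..DIM('a)}. q j)"
proof -
  have "0 < q i" if "i \<in> {1..DIM('a)}" for i
    using q_large[OF that] \<open>0 \<le> r\<close> by (cases "q i = 0") auto
  then obtain c :: "'a \<Rightarrow> nat" where c: "\<And>x. x \<in> L \<Longrightarrow> c x < (\<Prod>j\<in>{1..DIM('a)}. q j)"
    and c2: "\<And>x y. x \<in> L \<Longrightarrow> y \<in> L \<Longrightarrow> c x = c y \<Longrightarrow> x \<noteq> y \<Longrightarrow>
         \<exists>j\<in>{1..DIM('a)}. \<exists>w\<in>L. w \<notin> span (v ` {1..<j}) \<and> x - y = real (q j) *\<^sub>R w"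
    using separating_colouring[of q "DIM('a)", OF _ q_dvd order_refl] unfolding separating_def v_span Int_UNIV_right by blast
  have "inj_on c {x \<in> L. p x \<le> r}"
  proof (rule inj_onI, rule ccontr)
    fix x y assume xy: "x \<in> {x \<in> L. p x \<le> r}" "y \<in> {x \<in> L. p x \<le> r}" "c x = c y" "x \<noteq> y"
    then obtain j w where j: "j \<in> {1..DIM('a)}" "w \<in> L" "w \<notin> span (v ` {1..<j})"
      "x - y = real (q j) *\<^sub>R w"
      using c2[of x y] by auto
    have "real (q j) * p (v j) \<le> real (q j) * p w"
      using v_min[OF j(1-3)] by (intro mult_left_mono) auto
    also have "\<dots> = p (x - y)" by (simp add: j scale)
    also have "\<dots> \<le> 2 * r" using p_diff[of x y] xy by simp
    finally show False using q_large[OF j(1)] by simp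
  qed
  then have "card {x \<in> L. p x \<le> r} = card (c ` {x \<in> L. p x \<le> r})"
    by (simp add: card_image)
  also have "\<dots> \<le> card {..<(\<Prod>j\<in>{1..DIM('a)}. q j)}"
    using c by (intro card_mono) auto
  finally show ?thesis by simp
qed

text \<open>Powers of two turn the monotonicity of the exponents into the divisibility that the
  colouring requires.\<close>

lemma card_le_two:
  assumes "p (v DIM('a)) \<le> 1"
  shows "real (card {x \<in> L. p x \<le> 2}) \<le> (\<Prod>j\<in>{1..DIM('a)}. 8 / p (v j))"
proof -
  define e where "e i = (LEAST n. 4 < 2 ^ n * p (v i))" for i
  have ex: "\<exists>n. 4 < 2 ^ n * p (v i)" if "i \<in> {1..DIM('a)}" for i
  proof -
    obtain n where "4 / p (v i) < 2 ^ n" using real_arch_pow[of 2 "4 / p (v i)"] by auto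
    then show ?thesis using v_pos[OF that] by (auto simp: field_simps)
  qed
  have e: "4 < 2 ^ e i * p (v i)" if "i \<in> {1..DIM('a)}" for i
    unfolding e_def using ex[OF that] by (rule LeastI_ex)
  have e_mono: "e j \<le> e i" if "1 \<le> i" "i \<le> j" "j \<le> DIM('a)" for i j
  proof -
    have "4 < 2 ^ e i * p (v i)" using e that by auto
    also have "\<dots> \<le> 2 ^ e i * p (v j)" using v_mono[OF that] by simp
    finally show ?thesis unfolding e_def[of j] by (rule Least_le)
  qed
  have e_upper: "2 ^ e i \<le> 8 / p (v i)" if i: "i \<in> {1..DIM('a)}" for i
  proof -
    \<comment> \<open>The bound on the norms excludes the exponent 0, so the preceding exponent
      exists and fails the condition; this costs the factor 2 from 4 to 8.\<close>
    have "p (v i) \<le> 1" using v_mono[of i "DIM('a)"] assms i by simp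
    with e[OF i] have "e i \<noteq> 0" by (intro notI) simp
    then obtain m where m: "e i = Suc m" by (cases "e i") auto
    then have "\<not> 4 < 2 ^ m * p (v i)" unfolding e_def by (intro not_less_Least) simp
    then show ?thesis using v_pos[OF i] by (simp add: m field_simps)
  qed
  have "card {x \<in> L. p x \<le> 2} \<le> (\<Prod>j\<in>{1..DIM('a)}. 2 ^ e j)"
    using e e_mono by (intro card_le_prod) (auto intro: le_imp_power_dvd)
  then have "real (card {x \<in> L. p x \<le> 2}) \<le> (\<Prod>j\<in>{1..DIM('a)}. 2 ^ e j)"
    by (metis (mono_tags, lifting) of_nat_le_iff of_nat_numeral of_nat_power of_nat_prod prod.cong)
  also have "\<dots> \<le> (\<Prod>j\<in>{1..DIM('a)}. 8 / p (v j))"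
    using e_upper by (intro prod_mono) auto
  finally show ?thesis .
qed

end

subsection \<open>Covering by affine subspaces\<close>

text \<open>Exchange: \<open>I - {1..k}\<close> and \<open>{1..k} - I\<close> have equally many
  elements; on the former \<open>f\<close> is at most \<open>f k\<close>, on the latter at least
  \<open>f k\<close>.\<close>

lemma prod_le_prod_initial:
  fixes f :: "nat \<Rightarrow> nat"
  assumes anti: "\<And>i j. 1 \<le> i \<Longrightarrow> i \<le> j \<Longrightarrow> j \<le> n \<Longrightarrow> f j \<le> f i"
    and I: "I \<subseteq> {1..n}" "card I = k"
  shows "(\<Prod>i\<in>I. f i) \<le> (\<Prod>i\<in>{1..k}. f i)"
proof -
  let ?K = "{1..k}"
  have fin: "finite I" using I finite_subset by blast
  have "k \<le> n" using I card_mono[of "{1..n}" I] by simp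
  have "card (I - ?K) = card (?K - I)"
    using I fin card_Diff_subset_Int[of I ?K] card_Diff_subset_Int[of ?K I]
    by (simp add: Int_commute)
  have "(\<Prod>i\<in>I - ?K. f i) \<le> (\<Prod>i\<in>I - ?K. f k)"
  proof (rule prod_mono)
    fix i assume "i \<in> I - ?K"
    then show "0 \<le> f i \<and> f i \<le> f k"
      using anti[of k i] I \<open>card (I - ?K) = card (?K - I)\<close> fin by (cases "k = 0") auto
  qed
  also have "\<dots> = (\<Prod>i\<in>?K - I. f k)"
    using \<open>card (I - ?K) = card (?K - I)\<close> by simp
  also have "\<dots> \<le> (\<Prod>i\<in>?K - I. f i)"
    using anti \<open>k \<le> n\<close> by (intro prod_mono) auto
  finally have "(\<Prod>i\<in>I \<inter> ?K. f i) * (\<Prod>i\<in>I - ?K. f i) \<le> (\<Prod>i\<in>?K \<inter> I. f i) * (\<Prod>i\<in>?K - I. f i)"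
    by (simp add: Int_commute)
  then show ?thesis
    using fin prod.Int_Diff[of I f ?K] prod.Int_Diff[of ?K f I] by simp
qed

lemma coset_eq_iff:
  fixes x y :: "'a::real_vector"
  assumes "subspace V"
  shows "(+) x ` V = (+) y ` V \<longleftrightarrow> x - y \<in> V"
proof
  assume eq: "(+) x ` V = (+) y ` V"
  have "x + 0 \<in> (+) x ` V" using subspace_0[OF assms] by blast
  then obtain u where "u \<in> V" "x = y + u" using eq by auto
  then show "x - y \<in> V" by simp
next
  assume mem: "x - y \<in> V"
  have "x + u \<in> (+) y ` V" if "u \<in> V" for u
    using subspace_add[OF assms mem that] by (auto intro!: image_eqI[of _ _ "x - y + u"])
  moreover have "y + u \<in> (+) x ` V" if "u \<in> V" for u
    using subspace_diff[OF assms that mem] by (auto intro!: image_eqI[of _ _ "u - (x - y)"])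
  ultimately show "(+) x ` V = (+) y ` V" by blast
qed

lemma basis_complements_affine:
  fixes v :: "nat \<Rightarrow> 'a::euclidean_space"
  assumes ind: "independent (v ` {1..DIM('a)})" and inj: "inj_on v {1..DIM('a)}"
    and A: "affine_subspace_dim k A"
  obtains I where "I \<subseteq> {1..DIM('a)}" "card I = k"
    "\<And>x y. x \<in> A \<Longrightarrow> y \<in> A \<Longrightarrow> x - y \<in> span (v ` ({1..DIM('a)} - I)) \<Longrightarrow> x = y"
proof -
  let ?D = "{1..DIM('a)}"
  obtain a where a: "a \<in> A" using A by (auto simp: affine_subspace_dim_def)
  define W where "W = (\<lambda>x. x - a) ` A"
  have W: "subspace W"
    unfolding W_def using A a by (intro affine_diffs_subspace_subtract) (auto simp: affine_subspace_dim_def)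
  have dimW: "dim W = k"
    using A aff_dim_eq_dim_subtract[of a A] hull_inc[OF a, of affine]
    by (simp add: W_def affine_subspace_dim_def)
  obtain B where B: "B \<subseteq> W" "independent B" "W \<subseteq> span B" "card B = k"
    using basis_exists[of W] dimW by metis
  obtain C where C: "B \<subseteq> C" "C \<subseteq> B \<union> v ` ?D" "independent C" "B \<union> v ` ?D \<subseteq> span C"
    using maximal_independent_subset_extend[of B "B \<union> v ` ?D"] B(2) by blast
  have "dim (v ` ?D) = DIM('a)"
    using card_image[OF inj] dim_eq_card_independent[OF ind] by simp
  then have "span (v ` ?D) = UNIV" by (simp only: dim_eq_full)
  then have spanC: "span C = UNIV"
    using C(4) span_minimal[of "v ` ?D" "span C"] by auto
  then have cardC: "card C = DIM('a)"
    using dim_eq_card_independent[OF C(3)] by (simp flip: dim_eq_full)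
  have fin: "finite C" "finite B"
    using C(1,3) independent_bound finite_subset by blast+
  define J where "J = {i \<in> ?D. v i \<in> C - B}"
  have vJ: "v ` J = C - B" using C(2) by (auto simp: J_def)
  have cardCB: "card (C - B) = DIM('a) - k"
    using C(1) fin cardC B(4) by (simp add: card_Diff_subset)
  have "inj_on v J" using inj by (rule inj_on_subset) (auto simp: J_def)
  then have cardJ: "card J = DIM('a) - k" using card_image[of v J] vJ cardCB by simp
  have "k \<le> DIM('a)" using card_mono[OF fin(1) C(1)] B(4) cardC by simp
  have "{x + y |x y. x \<in> span B \<and> y \<in> span (C - B)} = span (B \<union> (C - B))"
    by (rule span_Un[symmetric])
  also have "\<dots> = UNIV" using C(1) spanC by (simp add: Un_absorb1)
  finally have "DIM('a) + dim (span B \<inter> span (C - B)) = dim (span B) + dim (span (C - B))"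
    using dim_sums_Int[OF subspace_span[of B] subspace_span[of "C - B"]] by simp
  also have "\<dots> = k + (DIM('a) - k)"
    using dim_eq_card_independent[OF B(2)] B(4) cardCB
      dim_eq_card_independent[OF independent_mono[OF C(3), of "C - B"]] by simp
  finally have "dim (span B \<inter> span (C - B)) = 0" using \<open>k \<le> DIM('a)\<close> by simp
  then have zero: "span B \<inter> span (C - B) \<subseteq> {0}" by (simp only: dim_eq_0)
  show ?thesis
  proof (rule that[of "?D - J"])
    show "card (?D - J) = k"
      using cardJ \<open>k \<le> DIM('a)\<close> by (subst card_Diff_subset) (auto simp: J_def)
    fix x y assume xy: "x \<in> A" "y \<in> A" "x - y \<in> span (v ` (?D - (?D - J)))"
    have "?D - (?D - J) = J" by (auto simp: J_def)
    with xy vJ have "x - y \<in> span (C - B)" by simp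
    moreover have "(x - a) - (y - a) \<in> W"
      by (rule subspace_diff[OF W]) (use xy in \<open>auto simp: W_def\<close>)
    then have "x - y \<in> span B" using B(3) by auto
    ultimately show "x = y" using zero by auto
  qed auto
qed

section \<open>Box points and the two covering bounds\<close>

context minimal_system
begin

text \<open>The divisor \<open>DIM('a)\<close> shares the unit norm equally among the coordinates,
  so that every box point has norm at most 1.\<close>

definition side :: "nat \<Rightarrow> nat" where
  "side i = nat \<lfloor>1 / (DIM('a) * p (v i))\<rfloor>"

text \<open>Used with all indices for the lower bound and with \<open>{1..k}\<close> for the upper
  bound. Extensional functions keep the box finite and the parametrization injective.\<close>

definition box :: "nat set \<Rightarrow> (nat \<Rightarrow> nat) set" where
  "box T = (\<Pi>\<^sub>E i\<in>T. {..side i})"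

definition point :: "nat set \<Rightarrow> (nat \<Rightarrow> nat) \<Rightarrow> 'a" where
  "point T a = (\<Sum>i\<in>T. real (a i) *\<^sub>R v i)"

lemma side_upper:
  assumes "i \<in> {1..DIM('a)}"
  shows "real (side i) * p (v i) \<le> 1 / DIM('a)"
proof -
  have "real (side i) \<le> 1 / (DIM('a) * p (v i))"
    using v_pos[OF assms] by (simp add: side_def)
  then show ?thesis using v_pos[OF assms] by (simp add: field_simps)
qed

lemma side_lower: "1 / (DIM('a) * p (v i)) \<le> real (side i + 1)"
  unfolding side_def by linarith

lemma side_antimono:
  assumes "1 \<le> i" "i \<le> j" "j \<le> DIM('a)"
  shows "side j \<le> side i"
proof -
  have "1 / (DIM('a) * p (v j)) \<le> 1 / (DIM('a) * p (v i))"
    using v_mono[OF assms] v_pos[of i] assms by (intro divide_left_mono mult_left_mono mult_pos_pos) auto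
  then show ?thesis unfolding side_def by (intro nat_mono floor_mono)
qed

lemma finite_box: "finite T \<Longrightarrow> finite (box T)"
  by (simp add: box_def finite_PiE)

lemma card_box: "finite T \<Longrightarrow> card (box T) = (\<Prod>i\<in>T. side i + 1)"
  by (simp add: box_def card_PiE)

lemma point_mem:
  assumes T: "T \<subseteq> {1..DIM('a)}" and a: "a \<in> box T"
  shows "point T a \<in> L" "p (point T a) \<le> 1"
proof -
  show "point T a \<in> L"
    unfolding point_def using T v_mem by (intro sum_mem nat_scale_mem) auto
  have "p (point T a) \<le> (\<Sum>i\<in>T. real (a i) * p (v i))"
    unfolding point_def using p_sum[of "\<lambda>i. real (a i) *\<^sub>R v i" T] by (simp add: scale)
  also have "\<dots> \<le> (\<Sum>i\<in>T. 1 / DIM('a))"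
  proof (rule sum_mono)
    fix i assume i: "i \<in> T"
    then have "a i \<le> side i" using a by (auto simp: box_def)
    then have "real (a i) * p (v i) \<le> real (side i) * p (v i)"
      using p_nonneg by (intro mult_right_mono) auto
    then show "real (a i) * p (v i) \<le> 1 / DIM('a)" using side_upper[of i] i T by auto
  qed
  also have "\<dots> \<le> 1"
    using card_mono[OF _ T] by (simp add: field_simps)
  finally show "p (point T a) \<le> 1" .
qed

lemma inj_point:
  assumes T: "T \<subseteq> {1..DIM('a)}"
  shows "inj_on (point T) (box T)"
proof (rule inj_onI)
  fix a b assume ab: "a \<in> box T" "b \<in> box T" "point T a = point T b"
  have "a i = b i" if "i \<in> T" for i
    using sum_v_eq[OF T ab(3)[unfolded point_def] that] by simp
  then show "a = b" using ab(1,2) unfolding box_def by (rule PiE_ext[rotated 2])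
qed

text \<open>Restriction to the \<open>k\<close> coordinates that determine points of
  \<open>A\<close> is injective. Since the sides decrease, the first \<open>k\<close> coordinates
  are the worst case.\<close>

lemma card_box_affine_le:
  assumes A: "affine_subspace_dim k A"
  shows "card {a \<in> box {1..DIM('a)}. point {1..DIM('a)} a \<in> A} \<le> (\<Prod>i\<in>{1..k}. side i + 1)"
proof -
  let ?D = "{1..DIM('a)}"
  let ?S = "{a \<in> box ?D. point ?D a \<in> A}"
  obtain I where I: "I \<subseteq> ?D" "card I = k"
    and eq: "\<And>x y. x \<in> A \<Longrightarrow> y \<in> A \<Longrightarrow> x - y \<in> span (v ` (?D - I)) \<Longrightarrow> x = y"
    using basis_complements_affine[OF v_independent v_inj A] by blast
  have fin: "finite I" using I finite_subset by blast
  have "inj_on (\<lambda>a. restrict a I) ?S"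
  proof (rule inj_onI)
    fix a b assume ab: "a \<in> ?S" "b \<in> ?S" "restrict a I = restrict b I"
    then have same: "a i = b i" if "i \<in> I" for i using that by (metis restrict_apply')
    have "point ?D a - point ?D b = (\<Sum>i\<in>?D. (real (a i) - real (b i)) *\<^sub>R v i)"
      by (simp add: point_def scaleR_left_diff_distrib sum_subtractf)
    also have "\<dots> = (\<Sum>i\<in>?D - I. (real (a i) - real (b i)) *\<^sub>R v i)"
      using same by (intro sum.mono_neutral_right) auto
    also have "\<dots> \<in> span (v ` (?D - I))"
      by (intro span_sum span_scale span_base) auto
    finally have "point ?D a = point ?D b" using ab by (intro eq) auto
    then show "a = b" using ab inj_onD[OF inj_point[of ?D]] by auto
  qed
  moreover have "(\<lambda>a. restrict a I) ` ?S \<subseteq> box I"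
    using I(1) by (auto simp: box_def)
  ultimately have "card ?S \<le> card (box I)"
    using finite_box[OF fin] by (intro card_inj_on_le)
  also have "\<dots> = (\<Prod>i\<in>I. side i + 1)" using fin by (rule card_box)
  also have "\<dots> \<le> (\<Prod>i\<in>{1..k}. side i + 1)"
    using I side_antimono by (intro prod_le_prod_initial[of "DIM('a)"]) auto
  finally show ?thesis .
qed

lemma prod_split:
  assumes "k \<le> DIM('a)"
  shows "(\<Prod>i\<in>{1..DIM('a)}. f i) = (\<Prod>i\<in>{1..k}. f i) * (\<Prod>i\<in>{k+1..DIM('a)}. f i)"
proof -
  have "{1..DIM('a)} = {1..k} \<union> {k+1..DIM('a)}" using assms by auto
  then show ?thesis by (simp add: prod.union_disjoint)
qed

text \<open>The subspaces must catch the whole box, each at most \<open>?Q\<close> of its points.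
  Cancelling \<open>?Q\<close> leaves the sides with index above \<open>k\<close>.\<close>

lemma card_cover_ge:
  assumes k: "k \<le> DIM('a)"
    and F: "finite F" "\<And>A. A \<in> F \<Longrightarrow> affine_subspace_dim k A" "{x \<in> L. p x \<le> 1} \<subseteq> \<Union>F"
  shows "(1 / DIM('a)) ^ (DIM('a) - k) / (\<Prod>i\<in>{k+1..DIM('a)}. p (v i)) \<le> real (card F)"
proof -
  let ?D = "{1..DIM('a)}" and ?Q = "\<Prod>i\<in>{1..k}. side i + 1"
  have "box ?D \<subseteq> (\<Union>A\<in>F. {a \<in> box ?D. point ?D a \<in> A})"
    using F(3) point_mem[of ?D] by blast
  then have "card (box ?D) \<le> card (\<Union>A\<in>F. {a \<in> box ?D. point ?D a \<in> A})"
    using F(1) finite_box[of ?D] by (intro card_mono) auto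
  also have "\<dots> \<le> (\<Sum>A\<in>F. card {a \<in> box ?D. point ?D a \<in> A})"
    by (rule card_UN_le[OF F(1)])
  also have "\<dots> \<le> card F * ?Q"
    using sum_mono[of F _ "\<lambda>_. ?Q"] card_box_affine_le F(2) by force
  finally have "?Q * (\<Prod>i\<in>{k+1..DIM('a)}. side i + 1) \<le> ?Q * card F"
    by (simp only: card_box finite_atLeastAtMost prod_split[OF k] mult.commute[of "card F"])
  moreover have "0 < ?Q" by (intro prod_pos) simp
  ultimately have le: "(\<Prod>i\<in>{k+1..DIM('a)}. side i + 1) \<le> card F"
    using mult_le_cancel1[of ?Q] by blast
  have "(1 / DIM('a)) ^ (DIM('a) - k) / (\<Prod>i\<in>{k+1..DIM('a)}. p (v i))
      = (\<Prod>i\<in>{k+1..DIM('a)}. 1 / (DIM('a) * p (v i)))"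
    by (simp add: prod_dividef prod.distrib power_divide)
  also have "\<dots> \<le> (\<Prod>i\<in>{k+1..DIM('a)}. real (side i + 1))"
    using side_lower p_nonneg by (intro prod_mono) auto
  also have "\<dots> = real (\<Prod>i\<in>{k+1..DIM('a)}. side i + 1)" by (simp only: of_nat_prod)
  also have "\<dots> \<le> real (card F)" using le by (rule of_nat_mono)
  finally show ?thesis .
qed

lemma exists_cover:
  assumes k: "k \<le> DIM('a)" and p1: "p (v DIM('a)) \<le> 1"
  shows "\<exists>F. finite F \<and> (\<forall>A\<in>F. affine_subspace_dim k A) \<and> {x \<in> L. p x \<le> 1} \<subseteq> \<Union>F \<and>
    real (card F) \<le> 8 ^ DIM('a) * DIM('a) ^ k / (\<Prod>i\<in>{k+1..DIM('a)}. p (v i))"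
proof -
  let ?K = "{1..k}"
  define V where "V = span (v ` ?K)"
  define S where "S = {x \<in> L. p x \<le> 1}"
  define coset where "coset x = (+) x ` V" for x
  have V: "subspace V" by (simp add: V_def)
  have K: "?K \<subseteq> {1..DIM('a)}" using k by auto
  have "finite S" using finite_le by (simp add: S_def)
  let ?F = "coset ` S"
  have "dim V = k"
    using dim_eq_card_independent[OF independent_mono[OF v_independent image_mono[OF K]]]
      card_image[OF inj_on_subset[OF v_inj K]] by (simp add: V_def)
  then have dims: "affine_subspace_dim k (coset x)" for x
    using V subspace_0[OF V]
    by (auto simp: affine_subspace_dim_def coset_def affine_translation[symmetric]
        subspace_imp_affine aff_dim_translation_eq aff_dim_subspace)
  have cover: "S \<subseteq> \<Union>?F"
    using subspace_0[OF V] by (force simp: coset_def)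
  \<comment> \<open>One point of \<open>S\<close> is kept for each translate. Adding the box points
    of \<open>V\<close> to it fills the translate with points of norm at most 2, and distinct
    translates are disjoint, so \<open>g\<close> is injective.\<close>
  define rep where "rep = inv_into S coset"
  have rep: "rep A \<in> S" "coset (rep A) = A" if "A \<in> ?F" for A
    using that by (auto simp: rep_def inv_into_into f_inv_into_f)
  define g where "g = (\<lambda>(A, a). rep A + point ?K a)"
  have pointV: "point ?K a \<in> V" for a
    unfolding V_def point_def by (intro span_sum span_scale span_base) auto
  have "inj_on g (?F \<times> box ?K)"
  proof (rule inj_onI)
    fix z z' assume "z \<in> ?F \<times> box ?K" "z' \<in> ?F \<times> box ?K" "g z = g z'"
    moreover obtain A a B b where z: "z = (A, a)" "z' = (B, b)" by (cases z, cases z')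
    ultimately have A: "A \<in> ?F" "a \<in> box ?K" and B: "B \<in> ?F" "b \<in> box ?K"
      and "g (A, a) = g (B, b)" by simp_all
    then have eq: "rep A + point ?K a = rep B + point ?K b" by (simp add: g_def)
    then have "rep A - rep B = point ?K b - point ?K a" by (simp add: algebra_simps)
    then have "rep A - rep B \<in> V" using subspace_diff[OF V pointV pointV] by simp
    then have "coset (rep A) = coset (rep B)" by (simp add: coset_def coset_eq_iff[OF V])
    then have "A = B" using rep(2) A(1) B(1) by simp
    with eq have "point ?K a = point ?K b" by simp
    then have "a = b" using inj_onD[OF inj_point[OF K]] A(2) B(2) by blast
    with \<open>A = B\<close> show "z = z'" by (simp add: z)
  qed
  moreover have "g ` (?F \<times> box ?K) \<subseteq> {x \<in> L. p x \<le> 2}"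
  proof
    fix z assume "z \<in> g ` (?F \<times> box ?K)"
    then obtain A a where "A \<in> ?F" and a: "a \<in> box ?K" and z: "z = rep A + point ?K a"
      by (auto simp: g_def)
    then have A: "rep A \<in> S" using rep(1) by blast
    then show "z \<in> {x \<in> L. p x \<le> 2}"
      using point_mem[OF K a] triangle[of "rep A" "point ?K a"] by (simp add: z S_def add_mem)
  qed
  ultimately have "card (?F \<times> box ?K) \<le> card {x \<in> L. p x \<le> 2}"
    using finite_le by (intro card_inj_on_le)
  then have "real (card ?F) * real (\<Prod>i\<in>?K. side i + 1) \<le> real (card {x \<in> L. p x \<le> 2})"
    by (simp only: card_cartesian_product card_box finite_atLeastAtMost of_nat_le_iff flip: of_nat_mult)
  also have "\<dots> \<le> (\<Prod>j\<in>{1..DIM('a)}. 8 / p (v j))" by (rule card_le_two[OF p1])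
  finally have "real (card ?F) * real (\<Prod>i\<in>?K. side i + 1) \<le> (\<Prod>j\<in>{1..DIM('a)}. 8 / p (v j))" .
  moreover have "(\<Prod>i\<in>?K. 1 / (DIM('a) * p (v i))) \<le> real (\<Prod>i\<in>?K. side i + 1)"
    unfolding of_nat_prod using side_lower p_nonneg by (intro prod_mono) auto
  then have "real (card ?F) * (\<Prod>i\<in>?K. 1 / (DIM('a) * p (v i)))
      \<le> real (card ?F) * real (\<Prod>i\<in>?K. side i + 1)"
    by (rule mult_left_mono) simp
  ultimately have "real (card ?F) * (\<Prod>i\<in>?K. 1 / (DIM('a) * p (v i)))
      \<le> (\<Prod>j\<in>{1..DIM('a)}. 8 / p (v j))" by linarith
  \<comment> \<open>The norms of the first \<open>k\<close> vectors appear on both sides and cancel,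
    which leaves only indices above \<open>k\<close>.\<close>
  then have "real (card ?F) / (DIM('a) ^ k * (\<Prod>i\<in>?K. p (v i)))
      \<le> 8 ^ DIM('a) / ((\<Prod>i\<in>?K. p (v i)) * (\<Prod>i\<in>{k+1..DIM('a)}. p (v i)))"
    unfolding prod_split[OF k, of "\<lambda>i. p (v i)", symmetric]
    by (simp add: prod_dividef prod.distrib)
  moreover have "0 < (\<Prod>i\<in>?K. p (v i))" "0 < (\<Prod>i\<in>{k+1..DIM('a)}. p (v i))"
    using v_pos k by (auto intro!: prod_pos)
  moreover have "c \<le> E * D / y" if "c / (D * x) \<le> E / (x * y)" "0 < x" "0 < y" "0 < D"
    for c D E x y :: real
    using that by (simp add: field_simps)
  ultimately have "real (card ?F) \<le> 8 ^ DIM('a) * DIM('a) ^ k / (\<Prod>i\<in>{k+1..DIM('a)}. p (v i))"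
    by simp
  then show ?thesis
    using \<open>finite S\<close> dims cover by (intro exI[of _ ?F]) (auto simp: S_def)
qed

text \<open>If \<open>p (v i) \<le> t\<close>, the first \<open>i\<close> vectors all belong to the
  set; otherwise minimality of \<open>v i\<close> confines it to the span of the first
  \<open>i - 1\<close>. As 0 belongs to it, affine and linear dimension agree.\<close>

lemma aff_dim_ge_iff:
  assumes i: "i \<in> {1..DIM('a)}" and t: "0 < t"
  shows "int i \<le> aff_dim {x \<in> L. p x \<le> t} \<longleftrightarrow> p (v i) \<le> t"
proof -
  let ?S = "{x \<in> L. p x \<le> t}"
  have "0 \<in> ?S" using t zero_mem by simp
  then have dim: "aff_dim ?S = int (dim ?S)" by (intro aff_dim_zero hull_inc)
  have "i \<le> dim ?S" if le: "p (v i) \<le> t"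
  proof -
    have I: "{1..i} \<subseteq> {1..DIM('a)}" using i by auto
    have "v j \<in> ?S" if "j \<in> {1..i}" for j
      using v_mem[of j] v_mono[of j i] that i le by auto
    then have "dim (v ` {1..i}) \<le> dim ?S" by (intro dim_subset) auto
    also have "dim (v ` {1..i}) = i"
      using dim_eq_card_independent[OF independent_mono[OF v_independent image_mono[OF I]]]
        card_image[OF inj_on_subset[OF v_inj I]] by simp
    finally show ?thesis .
  qed
  moreover have "dim ?S < i" if "t < p (v i)"
  proof -
    have "?S \<subseteq> span (v ` {1..<i})" using v_min[OF i] that by force
    then have "dim ?S \<le> card (v ` {1..<i})" by (intro dim_le_card) auto
    also have "\<dots> \<le> i - 1" using card_image_le[of "{1..<i}" v] by simp
    finally show ?thesis using i by auto
  qed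
  ultimately show ?thesis using dim by force
qed

end

lemma lattice_norm_gauge:
  assumes L: "is_lattice L" and K: "sym_convex_body K"
  shows "lattice_norm L (gauge_norm K)"
proof
  obtain M where M: "0 < M" "\<And>x. norm x \<le> M * gauge_norm K x"
    using gauge_norm_bound[OF K] by blast
  show "0 < gauge_norm K x" if "x \<noteq> 0" for x
    using M(2)[of x] M(1) that by (smt (verit) zero_less_mult_pos zero_less_norm_iff)
  show "finite {x \<in> L. gauge_norm K x \<le> r}" for r
  proof (rule finite_subset[OF _ lattice_finite_bounded[OF L]])
    show "{x \<in> L. gauge_norm K x \<le> r} \<subseteq> {x \<in> L. norm x \<le> M * r}"
      using M by (auto intro: order_trans[OF M(2)])
  qed
qed (use assms lattice_span[OF L] in
    \<open>auto intro: lattice_zero lattice_diff gauge_norm_triangle gauge_norm_scale\<close>)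

theorem theorem5:
  fixes k :: nat
  assumes "1 \<le> k" and "k \<le> DIM('a::euclidean_space) - 1"
  shows "\<exists>c1>0. \<exists>c2>0. \<forall>(L::'a set) K.
     is_lattice L \<and> sym_convex_body K \<and> succ_min L K DIM('a) \<le> 1 \<longrightarrow>
       (\<exists>F. finite F \<and> (\<forall>A\<in>F. affine_subspace_dim k A) \<and> L \<inter> K \<subseteq> \<Union>F \<and>
            real (card F) \<le> c2 / (\<Prod>i\<in>{k+1..DIM('a)}. succ_min L K i)) \<and>
       (\<forall>F. finite F \<and> (\<forall>A\<in>F. affine_subspace_dim k A) \<and> L \<inter> K \<subseteq> \<Union>F \<longrightarrow>
            real (card F) \<ge> c1 / (\<Prod>i\<in>{k+1..DIM('a)}. succ_min L K i))"
proof -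
  \<comment> \<open>\<open>?c1\<close> collects a factor \<open>1 / DIM('a)\<close> from each side
    with index above \<open>k\<close>. In \<open>?c2\<close> the power of 8 comes from the point
    count and the power of \<open>DIM('a)\<close> from the first \<open>k\<close> sides.\<close>
  let ?c1 = "(1 / real DIM('a)) ^ (DIM('a) - k)" and ?c2 = "8 ^ DIM('a) * real DIM('a) ^ k"
  have k: "k \<le> DIM('a)" using assms by simp
  have main: "(\<exists>F. finite F \<and> (\<forall>A\<in>F. affine_subspace_dim k A) \<and> L \<inter> K \<subseteq> \<Union>F \<and>
            real (card F) \<le> ?c2 / (\<Prod>i\<in>{k+1..DIM('a)}. succ_min L K i)) \<and>
       (\<forall>F. finite F \<and> (\<forall>A\<in>F. affine_subspace_dim k A) \<and> L \<inter> K \<subseteq> \<Union>F \<longrightarrow>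
            ?c1 / (\<Prod>i\<in>{k+1..DIM('a)}. succ_min L K i) \<le> real (card F))"
    if L: "is_lattice L" and K: "sym_convex_body K" and le1: "succ_min L K DIM('a) \<le> 1"
    for L K :: "'a set"
  proof -
    interpret lattice_norm L "gauge_norm K" by (rule lattice_norm_gauge[OF L K])
    obtain v where v: "\<forall>i\<in>{1..DIM('a)}. v i \<in> L \<and> v i \<notin> span (v ` {1..<i}) \<and>
        (\<forall>x\<in>L. x \<notin> span (v ` {1..<i}) \<longrightarrow> gauge_norm K (v i) \<le> gauge_norm K x)"
      using successive_minimizers[OF order_refl] by blast
    interpret minimal_system L "gauge_norm K" v
      by unfold_locales (use v in simp_all)
    have scaled: "L \<inter> (\<lambda>x. t *\<^sub>R x) ` K = {x \<in> L. gauge_norm K x \<le> t}" if "0 < t" for t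
      using mem_scaled_iff[OF that] gauge_norm_le_iff[OF K that] by auto
    have min: "succ_min L K i = gauge_norm K (v i)" if i: "i \<in> {1..DIM('a)}" for i
    proof -
      \<comment> \<open>The admissible scales form a closed ray; its left end is positive, so the
        condition \<open>0 < t\<close> removes nothing from it.\<close>
      have "{t. 0 < t \<and> int i \<le> aff_dim (L \<inter> (\<lambda>x. t *\<^sub>R x) ` K)} = {gauge_norm K (v i)..}"
        using scaled aff_dim_ge_iff[OF i] v_pos[OF i] by auto
      then show ?thesis by (simp add: succ_min_def)
    qed
    have unit: "L \<inter> K = {x \<in> L. gauge_norm K x \<le> 1}" using scaled[of 1] by simp
    have "(\<Prod>i\<in>{k+1..DIM('a)}. succ_min L K i) = (\<Prod>i\<in>{k+1..DIM('a)}. gauge_norm K (v i))"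
      using min by (intro prod.cong) auto
    moreover have "gauge_norm K (v DIM('a)) \<le> 1" using le1 min[of "DIM('a)"] by simp
    ultimately show ?thesis
      using exists_cover[OF k] card_cover_ge[OF k] unfolding unit by simp
  qed
  show ?thesis
    by (rule exI[of _ ?c1], rule conjI, simp, rule exI[of _ ?c2], rule conjI, simp,
        intro allI impI, elim conjE, rule main)
qed

end
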